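(* Any subgroup of a specular group is specular.
   Context: Let $A$ be a finite alphabet with an involution $\theta:A\to A$ (that is, $\theta\circ\theta=\mathrm{id}$), possibly with some fixed points. $G_\theta$ denotes the group generated by $A$ with the relations $a\,\theta(a)=1$ for every $a\in A$. It is a free product of a free group and a finite number of copies of $\mathbb{Z}/2\mathbb{Z}$, that is, $G_\theta=\mathbb{Z}^{*i}*(\mathbb{Z}/2\mathbb{Z})^{*j}$, where $i$ is the number of orbits of $\theta$ with two elements and $j$ is the number of its fixed points. Such a group is called a specular group (of type $(i,j)$).
   Formalization: With a finite alphabet the claim fails for subgroups that are not finitely generated (e.g. the commutator subgroup of a free group of rank 2), so any subgroup is shown specular over a countable alphabet, and over a finite alphabet when it is finitely generated. *)

theory Defs
  imports "HOL-Algebra.Generated_Groups"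
begin

text \<open>
  A word over \<^term>\<open>A\<close> and its formal inverses: the pair \<^term>\<open>(a, True)\<close> stands for the
  generator \<^term>\<open>a\<close> and \<^term>\<open>(a, False)\<close> for its inverse.  The relation below is the least congruence
  on such words that cancels adjacent mutually inverse letters and trivialises the relators
  in \<^term>\<open>R\<close>, so that its quotient is the group presented by \<^term>\<open>A\<close> and \<^term>\<open>R\<close>.
\<close>

type_synonym 'a sword = "('a \<times> bool) list"

inductive pres_eq :: "'a set \<Rightarrow> 'a sword set \<Rightarrow> 'a sword \<Rightarrow> 'a sword \<Rightarrow> bool"
  for A :: "'a set" and R :: "'a sword set"
where
  refl: "w \<in> lists (A \<times> UNIV) \<Longrightarrow> pres_eq A R w w"
| sym: "pres_eq A R u v \<Longrightarrow> pres_eq A R v u"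
| trans: "pres_eq A R u v \<Longrightarrow> pres_eq A R v w \<Longrightarrow> pres_eq A R u w"
| append: "pres_eq A R u v \<Longrightarrow> pres_eq A R u' v' \<Longrightarrow> pres_eq A R (u @ u') (v @ v')"
| cancel: "a \<in> A \<Longrightarrow> pres_eq A R [(a, s), (a, \<not> s)] []"
| relator: "r \<in> R \<Longrightarrow> r \<in> lists (A \<times> UNIV) \<Longrightarrow> pres_eq A R r []"

definition pres_rel :: "'a set \<Rightarrow> 'a sword set \<Rightarrow> 'a sword rel" where
  "pres_rel A R = {(u, v). pres_eq A R u v}"

definition presented_group :: "'a set \<Rightarrow> 'a sword set \<Rightarrow> 'a sword set monoid" where
  "presented_group A R =
    \<lparr> carrier = lists (A \<times> UNIV) // pres_rel A R,
      mult = (\<lambda>X Y. \<Union>x\<in>X. \<Union>y\<in>Y. pres_rel A R `` {x @ y}),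
      one = pres_rel A R `` {[]} \<rparr>"

definition involution_on :: "'a set \<Rightarrow> ('a \<Rightarrow> 'a) \<Rightarrow> bool" where
  "involution_on A \<theta> \<longleftrightarrow> \<theta> \<in> A \<rightarrow> A \<and> (\<forall>a\<in>A. \<theta> (\<theta> a) = a)"

definition involution_group :: "'a set \<Rightarrow> ('a \<Rightarrow> 'a) \<Rightarrow> 'a sword set monoid" where
  "involution_group A \<theta> = presented_group A {[(a, True), (\<theta> a, True)] | a. a \<in> A}"

text \<open>
  Specular groups are understood up to isomorphism.  As only the cardinality of the alphabet
  and the orbits of the involution matter, a finite alphabet may be taken to consist of natural numbers;
  lemma \<open>specular_group_involution_group\<close> below shows that this is no restriction.
\<close>

definition specular_group :: "('g, 'm) monoid_scheme \<Rightarrow> bool" where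
  "specular_group G \<longleftrightarrow> group G \<and>
    (\<exists>(A :: nat set) \<theta>. finite A \<and> involution_on A \<theta> \<and> G \<cong> involution_group A \<theta>)"

text \<open>
  The same notion without finiteness of the alphabet, as needed for subgroups that are
  not finitely generated (such as the commutator subgroup of a free group of rank two).
  Subgroups of finitely generated groups are countable, whence countable alphabets suffice.
\<close>

definition countable_specular_group :: "('g, 'm) monoid_scheme \<Rightarrow> bool" where
  "countable_specular_group G \<longleftrightarrow> group G \<and>
    (\<exists>(A :: nat set) \<theta>. involution_on A \<theta> \<and> G \<cong> involution_group A \<theta>)"

definition finitely_generated :: "('g, 'm) monoid_scheme \<Rightarrow> bool" where
  "finitely_generated G \<longleftrightarrow>
    (\<exists>S. finite S \<and> S \<subseteq> carrier G \<and> generate G S = carrier G)"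


lemma pres_eq_in_lists:
  "pres_eq A R u v \<Longrightarrow> u \<in> lists (A \<times> UNIV) \<and> v \<in> lists (A \<times> UNIV)"
  by (induction rule: pres_eq.induct) auto

lemma equiv_pres_rel: "equiv (lists (A \<times> UNIV)) (pres_rel A R)"
  unfolding equiv_def refl_on_def sym_def trans_def pres_rel_def
  by (auto dest: pres_eq_in_lists intro: pres_eq.intros)

abbreviation pres_class :: "'a set \<Rightarrow> 'a sword set \<Rightarrow> 'a sword \<Rightarrow> 'a sword set" where
  "pres_class A R w \<equiv> pres_rel A R `` {w}"

lemma pres_class_eq_iff:
  assumes "u \<in> lists (A \<times> UNIV)" "v \<in> lists (A \<times> UNIV)"
  shows "pres_class A R u = pres_class A R v \<longleftrightarrow> pres_eq A R u v"
  using eq_equiv_class_iff[OF equiv_pres_rel assms, of R] by (simp add: pres_rel_def)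

lemma carrier_presented_group:
  "carrier (presented_group A R) = pres_class A R ` lists (A \<times> UNIV)"
  by (auto simp: presented_group_def quotient_def)

lemma one_presented_group: "\<one>\<^bsub>presented_group A R\<^esub> = pres_class A R []"
  by (simp add: presented_group_def)

lemma mult_presented_group:
  assumes "u \<in> lists (A \<times> UNIV)" "v \<in> lists (A \<times> UNIV)"
  shows "pres_class A R u \<otimes>\<^bsub>presented_group A R\<^esub> pres_class A R v = pres_class A R (u @ v)"
proof -
  have *: "pres_class A R (x @ y) = pres_class A R (u @ v)"
    if "pres_eq A R u x" "pres_eq A R v y" for x y
  proof -
    have "pres_eq A R (x @ y) (u @ v)"
      using that by (blast intro: pres_eq.append pres_eq.sym)
    moreover from this have "x @ y \<in> lists (A \<times> UNIV)" "u @ v \<in> lists (A \<times> UNIV)"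
      using pres_eq_in_lists by blast+
    ultimately show ?thesis by (simp only: pres_class_eq_iff)
  qed
  have "u \<in> pres_class A R u" "v \<in> pres_class A R v"
    using assms by (auto simp: pres_rel_def intro: pres_eq.refl)
  moreover have "pres_class A R (x @ y) = pres_class A R (u @ v)"
    if "x \<in> pres_class A R u" "y \<in> pres_class A R v" for x y
    using that by (intro *) (auto simp: pres_rel_def)
  ultimately have "(\<Union>x\<in>pres_class A R u. \<Union>y\<in>pres_class A R v. pres_class A R (x @ y))
      = pres_class A R (u @ v)"
    by blast
  then show ?thesis by (simp add: presented_group_def)
qed

definition sword_inv :: "'a sword \<Rightarrow> 'a sword" where
  "sword_inv w = rev (map (\<lambda>(a, s). (a, \<not> s)) w)"

lemma sword_inv_in_lists: "w \<in> lists (A \<times> UNIV) \<Longrightarrow> sword_inv w \<in> lists (A \<times> UNIV)"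
  by (auto simp: sword_inv_def)

lemma pres_eq_sword_inv:
  "w \<in> lists (A \<times> UNIV) \<Longrightarrow> pres_eq A R (sword_inv w @ w) []"
proof (induction w)
  case Nil
  then show ?case by (simp add: sword_inv_def pres_eq.refl)
next
  case (Cons x w)
  obtain a s where x: "x = (a, s)" by (cases x)
  have a: "a \<in> A" and w: "w \<in> lists (A \<times> UNIV)" using Cons.prems x by auto
  have "pres_eq A R [(a, \<not> s), (a, s)] []"
    using pres_eq.cancel[OF a, of R "\<not> s"] by simp
  then have "pres_eq A R (sword_inv w @ [(a, \<not> s), (a, s)] @ w) (sword_inv w @ [] @ w)"
    by (intro pres_eq.append pres_eq.refl w sword_inv_in_lists)
  then show ?case
    using Cons.IH[OF w] x by (auto simp: sword_inv_def intro: pres_eq.trans)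
qed

lemma group_presented_group: "group (presented_group A R)"
proof (rule groupI)
  let ?P = "presented_group A R"
  let ?W = "lists (A \<times> (UNIV :: bool set))"
  have car: "\<exists>w\<in>?W. X = pres_class A R w" if "X \<in> carrier ?P" for X
    using that unfolding carrier_presented_group by blast
  have cls: "pres_class A R w \<in> carrier ?P" if "w \<in> ?W" for w
    using that unfolding carrier_presented_group by blast
  have app: "u @ v \<in> ?W" if "u \<in> ?W" "v \<in> ?W" for u v
    using that by simp
  have Nil: "[] \<in> ?W" by simp
  show "X \<otimes>\<^bsub>?P\<^esub> Y \<in> carrier ?P" if "X \<in> carrier ?P" "Y \<in> carrier ?P" for X Y
    using car[OF that(1)] car[OF that(2)] cls app mult_presented_group by metis
  show "\<one>\<^bsub>?P\<^esub> \<in> carrier ?P"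
    unfolding one_presented_group by (rule cls[OF Nil])
  show "X \<otimes>\<^bsub>?P\<^esub> Y \<otimes>\<^bsub>?P\<^esub> Z = X \<otimes>\<^bsub>?P\<^esub> (Y \<otimes>\<^bsub>?P\<^esub> Z)"
    if XYZ: "X \<in> carrier ?P" "Y \<in> carrier ?P" "Z \<in> carrier ?P" for X Y Z
  proof -
    obtain u v w where "u \<in> ?W" "v \<in> ?W" "w \<in> ?W"
      and "X = pres_class A R u" "Y = pres_class A R v" "Z = pres_class A R w"
      using XYZ[THEN car] by blast
    then show ?thesis by (simp only: mult_presented_group app append_assoc)
  qed
  show "\<one>\<^bsub>?P\<^esub> \<otimes>\<^bsub>?P\<^esub> X = X" if X: "X \<in> carrier ?P" for X
  proof -
    obtain w where "w \<in> ?W" "X = pres_class A R w" using car[OF X] by blast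
    then show ?thesis by (simp only: one_presented_group mult_presented_group Nil append_Nil)
  qed
  show "\<exists>Y\<in>carrier ?P. Y \<otimes>\<^bsub>?P\<^esub> X = \<one>\<^bsub>?P\<^esub>" if X: "X \<in> carrier ?P" for X
  proof -
    obtain w where w: "w \<in> ?W" "X = pres_class A R w" using car[OF X] by blast
    note w' = sword_inv_in_lists[OF w(1)]
    have "pres_class A R (sword_inv w @ w) = pres_class A R []"
      using pres_eq_sword_inv[OF w(1)] pres_class_eq_iff[OF app[OF w' w(1)] Nil] by blast
    then have "pres_class A R (sword_inv w) \<otimes>\<^bsub>?P\<^esub> X = \<one>\<^bsub>?P\<^esub>"
      by (simp only: w(2) mult_presented_group[OF w' w(1)] one_presented_group)
    then show ?thesis using cls[OF w'] by blast
  qed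
qed

lemma pres_eq_relabel:
  assumes "pres_eq A R u v"
  shows "pres_eq (f ` A) (map (map_prod f id) ` R)
           (map (map_prod f id) u) (map (map_prod f id) v)"
  using assms
proof (induction rule: pres_eq.induct)
  case (cancel a s)
  then show ?case by (auto intro: pres_eq.cancel)
next
  case (relator r)
  then have "map (map_prod f id) r \<in> lists (f ` A \<times> UNIV)" by force
  then show ?case unfolding list.map(1) by (rule pres_eq.relator[OF imageI[OF relator(1)]])
next
  case (refl w)
  then have "map (map_prod f id) w \<in> lists (f ` A \<times> UNIV)" by force
  then show ?case by (rule pres_eq.refl)
next
  case (append u v u' v')
  then show ?case by (simp add: pres_eq.append)
qed (blast intro: pres_eq.sym pres_eq.trans)+

lemma presented_group_relabel:
  assumes inj: "inj_on f A" and R: "R \<subseteq> lists (A \<times> UNIV)"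
  shows "presented_group A R \<cong> presented_group (f ` A) (map (map_prod f id) ` R)"
proof -
  let ?F = "map (map_prod f id) :: 'a sword \<Rightarrow> 'b sword"
  let ?g = "inv_into A f"
  let ?G = "map (map_prod ?g id) :: 'b sword \<Rightarrow> 'a sword"
  let ?W = "lists (A \<times> (UNIV :: bool set))"
  let ?W' = "lists (f ` A \<times> (UNIV :: bool set))"
  let ?S = "?F ` R"
  have GF: "?G (?F w) = w" if "w \<in> ?W" for w
    using that inj by (induction w) auto
  have FW: "?F w \<in> ?W'" if "w \<in> ?W" for w using that by (induction w) auto
  have WF: "\<exists>w\<in>?W. w' = ?F w" if "w' \<in> ?W'" for w'
    using that
  proof (induction w')
    case (Cons x w')
    then obtain w where w: "w \<in> ?W" "w' = ?F w" using Cons.IH by blast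
    obtain a s where "a \<in> A" "x = (f a, s)" using Cons.hyps by (cases x) auto
    note this w
    then have "(a, s) # w \<in> ?W" "x # w' = ?F ((a, s) # w)" by auto
    then show ?case by (intro bexI)
  qed simp
  have gA: "?g ` f ` A = A" using inj by force
  have "(\<lambda>w. ?G (?F w)) ` R = (\<lambda>w. w) ` R" by (rule image_cong) (use GF R in blast)+
  then have gR: "?G ` ?S = R" by (simp only: image_image image_ident)
  have eq: "pres_eq (f ` A) ?S (?F u) (?F v) \<longleftrightarrow> pres_eq A R u v"
    if "u \<in> ?W" "v \<in> ?W" for u v
  proof
    assume "pres_eq (f ` A) ?S (?F u) (?F v)"
    from pres_eq_relabel[OF this, of ?g] show "pres_eq A R u v"
      unfolding gA gR GF[OF that(1)] GF[OF that(2)] .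
  qed (rule pres_eq_relabel)
  define h where "h X = pres_class (f ` A) ?S (?F (SOME w. w \<in> ?W \<and> X = pres_class A R w))" for X
  have h: "h (pres_class A R w) = pres_class (f ` A) ?S (?F w)" if w: "w \<in> ?W" for w
  proof -
    define v where "v = (SOME v. v \<in> ?W \<and> pres_class A R w = pres_class A R v)"
    have "v \<in> ?W \<and> pres_class A R w = pres_class A R v"
      unfolding v_def by (rule someI[of _ w]) (use w in simp)
    then have v: "v \<in> ?W" "pres_class A R w = pres_class A R v" by blast+
    from v(2) have "pres_eq A R w v" unfolding pres_class_eq_iff[OF w v(1)] .
    then have "pres_eq (f ` A) ?S (?F w) (?F v)" by (rule pres_eq_relabel)
    then have "pres_class (f ` A) ?S (?F w) = pres_class (f ` A) ?S (?F v)"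
      unfolding pres_class_eq_iff[OF FW[OF w] FW[OF v(1)]] .
    then show ?thesis unfolding h_def v_def by (rule HOL.sym)
  qed
  have "h \<in> iso (presented_group A R) (presented_group (f ` A) ?S)"
  proof (rule isoI)
    show "h \<in> hom (presented_group A R) (presented_group (f ` A) ?S)"
    proof (rule homI)
      fix X assume "X \<in> carrier (presented_group A R)"
      then show "h X \<in> carrier (presented_group (f ` A) ?S)"
        unfolding carrier_presented_group using h FW by blast
    next
      fix X Y assume "X \<in> carrier (presented_group A R)" "Y \<in> carrier (presented_group A R)"
      then obtain u v where uv: "u \<in> ?W" "v \<in> ?W" "X = pres_class A R u" "Y = pres_class A R v"
        unfolding carrier_presented_group by blast
      then have "u @ v \<in> ?W" by simp
      then show "h (X \<otimes>\<^bsub>presented_group A R\<^esub> Y)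
          = h X \<otimes>\<^bsub>presented_group (f ` A) ?S\<^esub> h Y"
        using uv FW by (simp only: mult_presented_group h map_append)
    qed
    show "bij_betw h (carrier (presented_group A R)) (carrier (presented_group (f ` A) ?S))"
    proof (rule bij_betw_imageI)
      show "inj_on h (carrier (presented_group A R))"
      proof (rule inj_onI)
        fix X Y assume "X \<in> carrier (presented_group A R)" "Y \<in> carrier (presented_group A R)"
          and hXY: "h X = h Y"
        then obtain u v where uv: "u \<in> ?W" "v \<in> ?W" "X = pres_class A R u" "Y = pres_class A R v"
          unfolding carrier_presented_group by blast
        have "pres_class (f ` A) ?S (?F u) = pres_class (f ` A) ?S (?F v)"
          using hXY uv h by simp
        then have "pres_eq (f ` A) ?S (?F u) (?F v)"
          using uv FW by (simp only: pres_class_eq_iff)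
        then show "X = Y" using uv eq by (simp only: pres_class_eq_iff)
      qed
      have "h ` pres_class A R ` ?W = (\<lambda>w. pres_class (f ` A) ?S (?F w)) ` ?W"
        unfolding image_image by (rule image_cong) (simp_all add: h)
      also have "\<dots> = pres_class (f ` A) ?S ` ?W'" using FW WF by blast
      finally show "h ` carrier (presented_group A R) = carrier (presented_group (f ` A) ?S)"
        unfolding carrier_presented_group .
    qed
  qed
  then show ?thesis unfolding is_iso_def by blast
qed

lemma specular_group_involution_group:
  fixes A :: "'a set"
  assumes A: "finite A" and inv: "involution_on A \<theta>"
  shows "specular_group (involution_group A \<theta>)"
proof -
  obtain f :: "'a \<Rightarrow> nat" where f: "inj_on f A"
    using finite_imp_inj_to_nat_seg[OF A] by blast
  define \<tau> where "\<tau> = f \<circ> \<theta> \<circ> inv_into A f"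
  have tau: "\<tau> (f a) = f (\<theta> a)" if "a \<in> A" for a
    using that f by (simp add: \<tau>_def)
  have "involution_on (f ` A) \<tau>"
    using inv tau by (auto simp: involution_on_def Pi_iff)
  moreover have "map (map_prod f id) ` {[(a, True), (\<theta> a, True)] | a. a \<in> A}
      = {[(b, True), (\<tau> b, True)] | b. b \<in> f ` A}" (is "_ ` ?R = ?S")
    using tau by (auto simp: image_iff) force+
  moreover have "?R \<subseteq> lists (A \<times> UNIV)"
    using inv by (auto simp: involution_on_def Pi_iff)
  ultimately have "involution_group A \<theta> \<cong> involution_group (f ` A) \<tau>"
    using presented_group_relabel[OF f, of ?R] by (simp only: involution_group_def)
  moreover have "group (involution_group A \<theta>)"
    unfolding involution_group_def by (rule group_presented_group)
  ultimately show ?thesis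
    using \<open>involution_on (f ` A) \<tau>\<close> finite_imageI[OF A, of f]
    unfolding specular_group_def by blast
qed

end

theory Submission
  imports Defs "HOL-Library.Countable_Set"
begin

text \<open>
  Choose a Schreier transversal \<open>rep\<close> of the right cosets of the subgroup \<open>H\<close> by growing a spanning
  tree of the coset graph from \<open>H\<close>, and let \<open>X\<close> be the set of Schreier generators
  \<open>rep C \<otimes> l \<otimes> inv rep (C #> l)\<close> other than \<open>\<one>\<close>.  It generates \<open>H\<close> and is closed under inversion,
  so the involution group of \<open>(X, inv)\<close> maps onto \<open>H\<close>.  Reading a word of the ambient group from the
  coset \<open>H\<close> and recording the Schreier generators met on the way respects the relations of the
  ambient group, and sends some word with value \<open>x\<close> to the letter \<open>x\<close>, for each \<open>x \<in> X\<close>.  Hence it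
  inverts the map onto \<open>H\<close>, and no normal forms are needed.  If \<open>H\<close> is finitely
  generated, then \<open>X\<close> is finite: the parity of the number of letters \<open>x\<close> and \<open>inv x\<close> in a word is
  invariant, so generators whose words avoid both of these letters do not generate \<open>x\<close>.
\<close>

section \<open>Evaluating words in a group\<close>

definition letter_val :: "('g, 'm) monoid_scheme \<Rightarrow> ('a \<Rightarrow> 'g) \<Rightarrow> 'a \<times> bool \<Rightarrow> 'g" where
  "letter_val G f l = (if snd l then f (fst l) else inv\<^bsub>G\<^esub> f (fst l))"

definition word_val :: "('g, 'm) monoid_scheme \<Rightarrow> ('a \<Rightarrow> 'g) \<Rightarrow> 'a sword \<Rightarrow> 'g" where
  "word_val G f w = foldr (\<lambda>l g. letter_val G f l \<otimes>\<^bsub>G\<^esub> g) w \<one>\<^bsub>G\<^esub>"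

lemma word_val_Nil [simp]: "word_val G f [] = \<one>\<^bsub>G\<^esub>"
  by (simp add: word_val_def)

lemma word_val_Cons [simp]: "word_val G f (l # w) = letter_val G f l \<otimes>\<^bsub>G\<^esub> word_val G f w"
  by (simp add: word_val_def)

abbreviation inv_relators :: "'a set \<Rightarrow> ('a \<Rightarrow> 'a) \<Rightarrow> 'a sword set" where
  "inv_relators A \<theta> \<equiv> {[(a, True), (\<theta> a, True)] | a. a \<in> A}"

lemma involution_on_closed: "involution_on A \<theta> \<Longrightarrow> a \<in> A \<Longrightarrow> \<theta> a \<in> A"
  by (auto simp: involution_on_def)

lemma involution_on_involutive: "involution_on A \<theta> \<Longrightarrow> a \<in> A \<Longrightarrow> \<theta> (\<theta> a) = a"
  by (auto simp: involution_on_def)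

context group
begin

lemma letter_val_closed:
  "f \<in> A \<rightarrow> carrier G \<Longrightarrow> l \<in> A \<times> UNIV \<Longrightarrow> letter_val G f l \<in> carrier G"
  by (cases l) (auto simp: letter_val_def)

lemma word_val_closed:
  "f \<in> A \<rightarrow> carrier G \<Longrightarrow> w \<in> lists (A \<times> UNIV) \<Longrightarrow> word_val G f w \<in> carrier G"
  by (induction w) (use letter_val_closed[of f A] in auto)

lemma word_val_append:
  assumes "f \<in> A \<rightarrow> carrier G" "u \<in> lists (A \<times> UNIV)" "v \<in> lists (A \<times> UNIV)"
  shows "word_val G f (u @ v) = word_val G f u \<otimes> word_val G f v"
  using assms(2)
proof (induction u)
  case Nil
  then show ?case using word_val_closed[OF assms(1,3)] by simp
next
  case (Cons l u)
  then have "letter_val G f l \<in> carrier G" "word_val G f u \<in> carrier G"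
    using letter_val_closed[OF assms(1)] word_val_closed[OF assms(1)] by auto
  then show ?case using Cons word_val_closed[OF assms(1,3)] by (simp add: m_assoc)
qed

text \<open>One half of von Dyck's theorem: evaluation descends to the presented group.\<close>

lemma word_val_pres_eq:
  assumes f: "f \<in> A \<rightarrow> carrier G"
    and R: "\<And>r. r \<in> R \<Longrightarrow> r \<in> lists (A \<times> UNIV) \<Longrightarrow> word_val G f r = \<one>"
    and "pres_eq A R u v"
  shows "word_val G f u = word_val G f v"
  using assms(3)
proof (induction rule: pres_eq.induct)
  case (append u v u' v')
  then show ?case
    using pres_eq_in_lists[OF append(1)] pres_eq_in_lists[OF append(2)] by (simp add: word_val_append[OF f])
next
  case (cancel a s)
  then have "f a \<in> carrier G" using f by auto
  then show ?case by (simp add: letter_val_def)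
qed (use R in auto)

text \<open>Evaluation is a homomorphism on classes, so injectivity only has to be tested on words
  of value \<open>\<one>\<close>. This reduces an isomorphism statement to facts about
  words.\<close>

lemma presented_group_iso:
  assumes f: "f \<in> A \<rightarrow> carrier G"
    and R: "\<And>r. r \<in> R \<Longrightarrow> r \<in> lists (A \<times> UNIV) \<Longrightarrow> word_val G f r = \<one>"
    and surj: "\<And>g. g \<in> carrier G \<Longrightarrow> \<exists>w\<in>lists (A \<times> UNIV). word_val G f w = g"
    and faithful: "\<And>w. w \<in> lists (A \<times> UNIV) \<Longrightarrow> word_val G f w = \<one> \<Longrightarrow> pres_eq A R w []"
  shows "presented_group A R \<cong> G"
proof -
  let ?P = "presented_group A R"
  let ?W = "lists (A \<times> (UNIV :: bool set))"
  \<comment> \<open>An arbitrary representative is evaluated; \<open>word_val_pres_eq\<close> makes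
    the result independent of the choice.\<close>
  define h where "h X = word_val G f (SOME w. w \<in> X)" for X
  have h: "h (pres_class A R w) = word_val G f w" if w: "w \<in> ?W" for w
  proof -
    have "w \<in> pres_class A R w" using w by (simp add: pres_rel_def pres_eq.refl)
    then have "(SOME v. v \<in> pres_class A R w) \<in> pres_class A R w" by (rule someI)
    then have "pres_eq A R w (SOME v. v \<in> pres_class A R w)" by (simp add: pres_rel_def)
    from word_val_pres_eq[OF f R this] show ?thesis unfolding h_def by simp
  qed
  have hom: "h \<in> hom ?P G"
  proof (rule homI)
    fix X Y assume "X \<in> carrier ?P" "Y \<in> carrier ?P"
    then obtain u v where uv: "u \<in> ?W" "v \<in> ?W"
      and XY: "X = pres_class A R u" "Y = pres_class A R v"
      unfolding carrier_presented_group by blast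
    then have "u @ v \<in> ?W" by simp
    then show "h (X \<otimes>\<^bsub>?P\<^esub> Y) = h X \<otimes> h Y"
      by (simp only: XY mult_presented_group[OF uv] h uv word_val_append[OF f uv])
  next
    fix X assume "X \<in> carrier ?P"
    then obtain w where w: "w \<in> ?W" "X = pres_class A R w"
      unfolding carrier_presented_group by blast
    show "h X \<in> carrier G"
      unfolding w(2) h[OF w(1)] by (rule word_val_closed[OF f w(1)])
  qed
  interpret hom: group_hom ?P G h
    using hom group_presented_group is_group by (simp add: group_hom_def group_hom_axioms_def)
  have "inj_on h (carrier ?P)"
    unfolding hom.inj_on_one_iff
  proof (intro allI impI)
    fix X assume "X \<in> carrier ?P" "h X = \<one>"
    then obtain w where w: "w \<in> ?W" "X = pres_class A R w"
      unfolding carrier_presented_group by blast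
    then have "word_val G f w = \<one>" using \<open>h X = \<one>\<close> h[OF w(1)] by (simp only:)
    then have "pres_eq A R w []" by (rule faithful[OF w(1)])
    then show "X = \<one>\<^bsub>?P\<^esub>"
      unfolding one_presented_group w(2) using pres_class_eq_iff[OF w(1)] by blast
  qed
  moreover have "h ` carrier ?P = carrier G"
  proof
    show "carrier G \<subseteq> h ` carrier ?P"
    proof
      fix g assume "g \<in> carrier G"
      then obtain w where w: "w \<in> ?W" "word_val G f w = g" using surj by blast
      then have "g = h (pres_class A R w)" by (simp only: h)
      moreover have "pres_class A R w \<in> carrier ?P"
        unfolding carrier_presented_group using w(1) by (rule imageI)
      ultimately show "g \<in> h ` carrier ?P" by (rule image_eqI)
    qed
  qed auto
  ultimately show ?thesis
    using hom unfolding is_iso_def iso_def bij_betw_def by blast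
qed

end

text \<open>Converse of \<open>presented_group_iso\<close>: with \<open>f\<close> the images of the
  single letters, evaluating a word gives the image of its class. The facts obtained are the
  assumptions of \<open>specular_subgroup\<close>.\<close>

lemma involution_group_isoE:
  assumes G: "group G" and inv: "involution_on A \<theta>" and iso: "G \<cong> involution_group A \<theta>"
  obtains f where "f \<in> A \<rightarrow> carrier G"
    and "\<And>a. a \<in> A \<Longrightarrow> f a \<otimes>\<^bsub>G\<^esub> f (\<theta> a) = \<one>\<^bsub>G\<^esub>"
    and "\<And>g. g \<in> carrier G \<Longrightarrow> \<exists>w\<in>lists (A \<times> UNIV). word_val G f w = g"
    and "\<And>w. w \<in> lists (A \<times> UNIV) \<Longrightarrow> word_val G f w = \<one>\<^bsub>G\<^esub> \<Longrightarrow>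
      pres_eq A (inv_relators A \<theta>) w []"
proof -
  let ?R = "inv_relators A \<theta>"
  let ?P = "presented_group A ?R"
  let ?W = "lists (A \<times> (UNIV :: bool set))"
  interpret G: group G by fact
  interpret P: group ?P by (rule group_presented_group)
  obtain h where h: "h \<in> iso ?P G"
    using G.iso_sym[OF iso] unfolding involution_group_def is_iso_def by blast
  then have "h \<in> hom ?P G" and bij: "bij_betw h (carrier ?P) (carrier G)"
    unfolding iso_def by blast+
  then interpret h: group_hom ?P G h
    by (simp add: group_hom_def group_hom_axioms_def G.is_group P.is_group)
  define f where "f a = h (pres_class A ?R [(a, True)])" for a
  have cls: "pres_class A ?R w \<in> carrier ?P" if "w \<in> ?W" for w
    using that unfolding carrier_presented_group by blast
  have letter: "letter_val G f l = h (pres_class A ?R [l])" if l: "l \<in> A \<times> UNIV" for l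
  proof (cases l)
    case (Pair a s)
    then have a: "[(a, True)] \<in> ?W" "[(a, False)] \<in> ?W" using l by auto
    have "pres_class A ?R ([(a, False)] @ [(a, True)]) = \<one>\<^bsub>?P\<^esub>"
      unfolding one_presented_group
      by (subst pres_class_eq_iff) (use a pres_eq.cancel[of a A ?R False] in auto)
    then have "pres_class A ?R [(a, False)] \<otimes>\<^bsub>?P\<^esub> pres_class A ?R [(a, True)] = \<one>\<^bsub>?P\<^esub>"
      by (simp only: mult_presented_group[OF a(2,1)])
    then have "inv\<^bsub>?P\<^esub> pres_class A ?R [(a, True)] = pres_class A ?R [(a, False)]"
      by (rule P.inv_equality[OF _ cls[OF a(1)] cls[OF a(2)]])
    then have "h (pres_class A ?R [(a, False)]) = inv\<^bsub>G\<^esub> f a"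
      unfolding f_def using h.hom_inv[OF cls[OF a(1)]] by (simp only:)
    then show ?thesis using Pair by (cases s) (simp_all add: letter_val_def f_def)
  qed
  have val: "word_val G f w = h (pres_class A ?R w)" if "w \<in> ?W" for w
    using that
  proof (induction w)
    case Nil
    then show ?case using h.hom_one by (simp add: one_presented_group)
  next
    case (Cons l w)
    have l: "[l] \<in> ?W" and w: "w \<in> ?W" using Cons by auto
    have "h (pres_class A ?R (l # w)) = h (pres_class A ?R [l]) \<otimes>\<^bsub>G\<^esub> h (pres_class A ?R w)"
      unfolding h.hom_mult[OF cls[OF l] cls[OF w], symmetric] mult_presented_group[OF l w] by simp
    moreover have "l \<in> A \<times> UNIV" using l by simp
    ultimately show ?case by (simp only: word_val_Cons letter Cons.IH)
  qed
  show thesis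
  proof
    show f: "f \<in> A \<rightarrow> carrier G"
      unfolding f_def by (intro funcsetI h.hom_closed cls) auto
    show "f a \<otimes>\<^bsub>G\<^esub> f (\<theta> a) = \<one>\<^bsub>G\<^esub>" if a: "a \<in> A" for a
    proof -
      let ?r = "[(a, True), (\<theta> a, True)]"
      have ta: "\<theta> a \<in> A" using inv a by (rule involution_on_closed)
      have r: "?r \<in> ?W" using a ta by simp
      have "pres_eq A ?R ?r []" by (rule pres_eq.relator) (use a r in auto)
      then have "pres_class A ?R ?r = \<one>\<^bsub>?P\<^esub>"
        unfolding one_presented_group using pres_class_eq_iff[OF r] by blast
      then have "word_val G f ?r = \<one>\<^bsub>G\<^esub>" using val[OF r] h.hom_one by (simp only:)
      moreover have "f (\<theta> a) \<in> carrier G" using f ta by auto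
      ultimately show ?thesis by (simp add: letter_val_def)
    qed
    show "\<exists>w\<in>?W. word_val G f w = g" if g: "g \<in> carrier G" for g
    proof -
      have "g \<in> h ` pres_class A ?R ` ?W"
        using g unfolding bij_betw_imp_surj_on[OF bij, symmetric] carrier_presented_group .
      then obtain w where w: "w \<in> ?W" "h (pres_class A ?R w) = g" by blast
      have "word_val G f w = g" unfolding val[OF w(1)] by (rule w(2))
      then show ?thesis using w(1) by (rule bexI)
    qed
    show "pres_eq A ?R w []" if w: "w \<in> ?W" "word_val G f w = \<one>\<^bsub>G\<^esub>" for w
    proof -
      have "h (pres_class A ?R w) = h \<one>\<^bsub>?P\<^esub>" by (simp only: val[OF w(1), symmetric] w(2) h.hom_one)
      then have "pres_class A ?R w = pres_class A ?R []"
        unfolding one_presented_group[symmetric]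
        by (rule inj_onD[OF bij_betw_imp_inj_on[OF bij] _ cls[OF w(1)] P.one_closed])
      then show ?thesis using pres_class_eq_iff[OF w(1)] by blast
    qed
  qed
qed

section \<open>Schreier generators\<close>

text \<open>The last three assumptions together say that \<open>f\<close> presents \<open>G\<close>
  as the involution group of \<open>A\<close> and \<open>\<theta>\<close>. They speak of elements of
  \<open>G\<close>, so that cosets of \<open>H\<close> can be formed in \<open>G\<close>
  itself.\<close>

locale specular_subgroup = group G + subgroup H G
  for G (structure) and H +
  fixes A :: "'b set" and \<theta> f
  assumes involution: "involution_on A \<theta>"
    and gen_closed: "f \<in> A \<rightarrow> carrier G"
    and gen_inv: "\<And>a. a \<in> A \<Longrightarrow> f a \<otimes> f (\<theta> a) = \<one>"
    and gen_surj: "\<And>g. g \<in> carrier G \<Longrightarrow> \<exists>w\<in>lists (A \<times> UNIV). word_val G f w = g"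
    and gen_faithful: "\<And>w. w \<in> lists (A \<times> UNIV) \<Longrightarrow> word_val G f w = \<one> \<Longrightarrow>
      pres_eq A (inv_relators A \<theta>) w []"
begin

section \<open>Words and letters of the ambient group\<close>

abbreviation "words \<equiv> lists (A \<times> (UNIV :: bool set))"
abbreviation "val \<equiv> word_val G f"
abbreviation "letters \<equiv> letter_val G f ` (A \<times> UNIV)"

lemma letters_closed: "l \<in> letters \<Longrightarrow> l \<in> carrier G"
  using letter_val_closed[OF gen_closed] by auto

lemma inv_gen:
  assumes "a \<in> A"
  shows "inv f a = f (\<theta> a)"
proof -
  have car: "f a \<in> carrier G" "f (\<theta> a) \<in> carrier G"
    using assms gen_closed involution_on_closed[OF involution] by auto
  have "inv f (\<theta> a) = f a" using gen_inv[OF assms] car by (simp add: inv_equality)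
  then show "inv f a = f (\<theta> a)" using inv_inv[OF car(2)] by simp
qed

text \<open>Formal inverses add no elements, since the inverse of \<open>f a\<close> is
  \<open>f (\<theta> a)\<close>. Hence the letters are closed under inversion and every edge of the
  coset graph can be walked back.\<close>

lemma letters_eq: "letters = f ` A"
proof
  show "letters \<subseteq> f ` A"
    using involution_on_closed[OF involution] by (auto simp: letter_val_def inv_gen)
  show "f ` A \<subseteq> letters"
    by (force simp: letter_val_def image_iff)
qed

lemma inv_letters: "l \<in> letters \<Longrightarrow> inv l \<in> letters"
  unfolding letters_eq using involution_on_closed[OF involution] by (auto simp: inv_gen)

lemma letters_induct [consumes 1, case_names one mult]:
  assumes "g \<in> carrier G" and "P \<one>"
    and "\<And>l g. l \<in> letters \<Longrightarrow> g \<in> carrier G \<Longrightarrow> P g \<Longrightarrow> P (l \<otimes> g)"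
  shows "P g"
proof -
  have "P (val w)" if "w \<in> words" for w
    using that by (induction w) (use assms word_val_closed[OF gen_closed] in auto)
  then show ?thesis using gen_surj[OF assms(1)] by auto
qed

section \<open>The coset graph and a Schreier transversal\<close>

lemma coset_closed: "C \<in> rcosets H \<Longrightarrow> g \<in> carrier G \<Longrightarrow> C #> g \<in> rcosets H"
  unfolding RCOSETS_def using coset_mult_assoc[OF subset] by auto

lemma coset_subset: "C \<in> rcosets H \<Longrightarrow> C \<subseteq> carrier G"
  using rcosets_part_G[OF subgroup_axioms] by auto

lemma coset_assoc:
  "C \<in> rcosets H \<Longrightarrow> g \<in> carrier G \<Longrightarrow> h \<in> carrier G \<Longrightarrow> (C #> g) #> h = C #> (g \<otimes> h)"
  by (simp add: coset_subset coset_mult_assoc)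

lemma coset_cancel:
  "C \<in> rcosets H \<Longrightarrow> g \<in> carrier G \<Longrightarrow> (C #> g) #> inv g = C"
  by (simp add: coset_subset coset_assoc)

lemma coset_eqI: "C \<in> rcosets H \<Longrightarrow> x \<in> C \<Longrightarrow> H #> x = C"
  unfolding RCOSETS_def using repr_independence[OF _ _ subgroup_axioms] by auto

lemma subgroup_coset: "H \<in> rcosets H"
  by (rule subgroup_in_rcosets[OF is_group])

text \<open>The distance from \<open>H\<close> in the coset graph, whose edges lead from
  \<open>C\<close> to \<open>C #> l\<close> for letters \<open>l\<close>.\<close>

definition depth :: "'a set \<Rightarrow> nat" where
  "depth C = (LEAST n. \<exists>w\<in>words. length w = n \<and> H #> val w = C)"

lemma depth_le: "w \<in> words \<Longrightarrow> depth (H #> val w) \<le> length w"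
  unfolding depth_def by (rule Least_le) auto

lemma depth_attained:
  assumes "C \<in> rcosets H"
  obtains w where "w \<in> words" "length w = depth C" "H #> val w = C"
proof -
  obtain g where "g \<in> carrier G" "C = H #> g" using assms by (auto simp: RCOSETS_def)
  then obtain w where "w \<in> words" "H #> val w = C" using gen_surj by blast
  then have "\<exists>n. \<exists>w\<in>words. length w = n \<and> H #> val w = C" by blast
  from LeastI_ex[OF this] show thesis using that unfolding depth_def by blast
qed

text \<open>Drop the last letter of a shortest word to \<open>C\<close>. The coset reached by the
  prefix is not closer to \<open>H\<close> than the prefix is long, since a shortcut to it would
  shorten the way to \<open>C\<close>.\<close>

lemma depth_parent:
  assumes C: "C \<in> rcosets H" "depth C = Suc n"
  shows "\<exists>D l. D \<in> rcosets H \<and> l \<in> letters \<and> depth D = n \<and> D #> l = C"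
proof -
  obtain w where w: "w \<in> words" "length w = Suc n" "H #> val w = C"
    using depth_attained[OF C(1)] C(2) by metis
  then obtain v b where v: "w = v @ [b]" by (metis Zero_not_Suc list.size(3) rev_exhaust)
  then have vb: "v \<in> words" "b \<in> A \<times> UNIV" "[b] \<in> words" "length v = n" using w by auto
  let ?l = "letter_val G f b"
  have car: "val v \<in> carrier G" "?l \<in> carrier G"
    using vb word_val_closed letter_val_closed gen_closed by metis+
  have D: "H #> val v \<in> rcosets H" using car subset by (simp add: rcosetsI)
  have eq: "(H #> val v) #> ?l = C"
    using w v vb car word_val_append[OF gen_closed vb(1,3)] subset
    by (simp add: coset_mult_assoc)
  \<comment> \<open>The lower bound \<open>n\<close> for the depth comes from
    \<open>u @ [b]\<close>, which also leads to \<open>C\<close>; the upper bound comes from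
    \<open>v\<close>.\<close>
  obtain u where u: "u \<in> words" "length u = depth (H #> val v)" "H #> val u = H #> val v"
    using depth_attained[OF D] .
  have ub: "u @ [b] \<in> words" using u(1) vb by simp
  have "val (u @ [b]) = val u \<otimes> ?l" "val u \<in> carrier G"
    using word_val_append[OF gen_closed u(1) vb(3)] word_val_closed[OF gen_closed u(1)] car by simp_all
  then have "H #> val (u @ [b]) = C"
    using eq u(3) coset_mult_assoc[OF subset _ car(2)] by metis
  then have "Suc n \<le> Suc (length u)" using depth_le[OF ub] C(2) by simp
  moreover have "depth (H #> val v) \<le> n" using depth_le[OF vb(1)] vb(4) by simp
  ultimately have "depth (H #> val v) = n" using u(2) by simp
  then show ?thesis using D eq vb(2) by blast
qed

lemma depth_zero: "C \<in> rcosets H \<Longrightarrow> depth C = 0 \<Longrightarrow> C = H"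
  by (erule depth_attained) (use subset in auto)

lemma depth_subgroup: "depth H = 0"
  using depth_le[of "[]"] subset by simp

text \<open>One parent edge chosen at every coset other than \<open>H\<close> gives a spanning tree;
  the representative is the product of the letters on the branch from \<open>H\<close>. The strict
  decrease of \<open>depth\<close> is recorded because it drives later inductions along
  branches.\<close>

lemma transversal_exists:
  "\<exists>r. r H = \<one> \<and> (\<forall>C\<in>rcosets H. r C \<in> C) \<and>
     (\<forall>C\<in>rcosets H. C \<noteq> H \<longrightarrow>
       (\<exists>D\<in>rcosets H. \<exists>l\<in>letters. depth D < depth C \<and> D #> l = C \<and> r C = r D \<otimes> l))"
proof -
  obtain p q where pq: "\<And>C n. C \<in> rcosets H \<Longrightarrow> depth C = Suc n \<Longrightarrow>
      p C \<in> rcosets H \<and> q C \<in> letters \<and> depth (p C) = n \<and> p C #> q C = C"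
  proof -
    \<comment> \<open>Pairs are used so that \<open>bchoice\<close> selects the parent coset and the
      edge letter together.\<close>
    let ?P = "\<lambda>C x. fst x \<in> rcosets H \<and> snd x \<in> letters \<and> Suc (depth (fst x)) = depth C \<and>
      fst x #> snd x = C"
    have "\<forall>C\<in>{C \<in> rcosets H. depth C \<noteq> 0}. \<exists>x. ?P C x"
    proof
      fix C assume "C \<in> {C \<in> rcosets H. depth C \<noteq> 0}"
      then have "C \<in> rcosets H" "depth C = Suc (depth C - 1)" by auto
      from depth_parent[OF this] obtain D l where "D \<in> rcosets H" "l \<in> letters"
        "depth D = depth C - 1" "D #> l = C" by blast
      with \<open>depth C = Suc (depth C - 1)\<close> show "\<exists>x. ?P C x" by (intro exI[of _ "(D, l)"]) simp
    qed
    from bchoice[OF this] obtain x where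
      "\<forall>C\<in>{C \<in> rcosets H. depth C \<noteq> 0}. ?P C (x C)" ..
    then show thesis by (intro that[of "fst \<circ> x" "snd \<circ> x"]) auto
  qed
  \<comment> \<open>The recursion is on the distance, with the coset as argument:
    \<open>t n C\<close> multiplies the edge letters on the last \<open>n\<close> steps towards
    \<open>C\<close>, and only \<open>n = depth C\<close> matters.\<close>
  define t where "t = rec_nat (\<lambda>C. \<one>) (\<lambda>n s C. s (p C) \<otimes> q C)"
  have t: "t 0 C = \<one>" "t (Suc n) C = t n (p C) \<otimes> q C" for C n by (simp_all add: t_def)
  define r where "r C = t (depth C) C" for C
  have step: "\<exists>D\<in>rcosets H. \<exists>l\<in>letters. depth D < depth C \<and> D #> l = C \<and> r C = r D \<otimes> l"
    if C: "C \<in> rcosets H" "C \<noteq> H" for C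
  proof -
    obtain n where n: "depth C = Suc n" using depth_zero C by (cases "depth C") auto
    then have "r C = r (p C) \<otimes> q C" using pq[OF C(1) n] by (simp add: r_def t)
    then show ?thesis using pq[OF C(1) n] n by (metis lessI)
  qed
  have one: "r H = \<one>" by (simp add: r_def t depth_subgroup)
  have "r C \<in> C" if "C \<in> rcosets H" for C
    using that
  proof (induction "depth C" arbitrary: C rule: less_induct)
    case less
    show ?case
    proof (cases "C = H")
      case False
      then obtain D l where "D \<in> rcosets H" "l \<in> letters" "depth D < depth C" "D #> l = C"
        "r C = r D \<otimes> l" using step less.prems by blast
      then show ?thesis using less.hyps by (auto simp: r_coset_def)
    qed (simp add: one)
  qed
  then show ?thesis using one step by blast
qed

definition rep :: "'a set \<Rightarrow> 'a" where
  "rep = (SOME r. r H = \<one> \<and> (\<forall>C\<in>rcosets H. r C \<in> C) \<and>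
     (\<forall>C\<in>rcosets H. C \<noteq> H \<longrightarrow>
       (\<exists>D\<in>rcosets H. \<exists>l\<in>letters. depth D < depth C \<and> D #> l = C \<and> r C = r D \<otimes> l)))"

lemma rep_subgroup: "rep H = \<one>"
  and rep_in: "C \<in> rcosets H \<Longrightarrow> rep C \<in> C"
  and rep_parent: "C \<in> rcosets H \<Longrightarrow> C \<noteq> H \<Longrightarrow>
    \<exists>D\<in>rcosets H. \<exists>l\<in>letters. depth D < depth C \<and> D #> l = C \<and> rep C = rep D \<otimes> l"
  using someI_ex[OF transversal_exists] unfolding rep_def[symmetric] by blast+

lemma rep_closed: "C \<in> rcosets H \<Longrightarrow> rep C \<in> carrier G"
  using rep_in coset_subset by blast

lemma coset_rep: "C \<in> rcosets H \<Longrightarrow> H #> rep C = C"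
  by (simp add: coset_eqI rep_in)

section \<open>Schreier generators as a cocycle with values in \<open>H\<close>\<close>

definition schreier :: "'a set \<Rightarrow> 'a \<Rightarrow> 'a" where
  "schreier C g = rep C \<otimes> g \<otimes> inv rep (C #> g)"

text \<open>\<open>rep C \<otimes> g\<close> lies in the coset \<open>C #> g\<close>, so it differs
  from the representative of that coset by a left factor in \<open>H\<close>.\<close>

lemma schreier_closed:
  assumes "C \<in> rcosets H" "g \<in> carrier G"
  shows "schreier C g \<in> H"
proof -
  have car: "rep C \<in> carrier G" "rep (C #> g) \<in> carrier G"
    using assms rep_closed coset_closed by auto
  have "H #> rep (C #> g) = H #> (rep C \<otimes> g)"
    using assms car coset_rep coset_closed coset_mult_assoc[OF subset] by metis
  then have "rep C \<otimes> g \<in> H #> rep (C #> g)"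
    using repr_independenceD[OF subgroup_axioms] car assms by auto
  then obtain h where h: "h \<in> H" "rep C \<otimes> g = h \<otimes> rep (C #> g)" by (auto simp: r_coset_def)
  then have "schreier C g = h"
    unfolding schreier_def using car by (simp add: inv_solve_right')
  then show ?thesis using h by simp
qed

text \<open>The representative of \<open>C #> g\<close> cancels in the middle. For the sake of this
  cocycle identity \<open>schreier\<close> takes arbitrary group elements: its value on a product
  telescopes into values on letters.\<close>

lemma schreier_mult:
  assumes "C \<in> rcosets H" "g \<in> carrier G" "h \<in> carrier G"
  shows "schreier C (g \<otimes> h) = schreier C g \<otimes> schreier (C #> g) h"
proof -
  have "rep C \<in> carrier G" "rep (C #> g) \<in> carrier G" "rep (C #> (g \<otimes> h)) \<in> carrier G"
    using assms rep_closed coset_closed by auto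
  moreover from this have "inv rep (C #> g) \<otimes> (rep (C #> g) \<otimes> z) = z" if "z \<in> carrier G" for z
    using that by (simp add: m_assoc[symmetric])
  ultimately show ?thesis
    using assms unfolding schreier_def by (simp add: coset_assoc m_assoc)
qed

lemma schreier_one: "C \<in> rcosets H \<Longrightarrow> schreier C \<one> = \<one>"
  unfolding schreier_def by (simp add: coset_subset rep_closed)

text \<open>Walking back along an edge inverts its generator, by the cocycle identity for
  \<open>inv g\<close> and \<open>g\<close> at \<open>C #> g\<close>. This makes
  \<open>basis\<close> closed under inversion.\<close>

lemma schreier_inv:
  assumes "C \<in> rcosets H" "g \<in> carrier G"
  shows "inv schreier C g = schreier (C #> g) (inv g)"
proof -
  have "schreier (C #> g) (inv g) \<otimes> schreier C g = \<one>"
    using schreier_mult[of "C #> g" "inv g" g] assms coset_closed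
    by (simp add: coset_cancel schreier_one)
  then show ?thesis
    using assms schreier_closed coset_closed by (simp add: inv_equality)
qed

text \<open>These are elements of \<open>G\<close>, not edges: edges with equal Schreier generators
  are identified. Tree edges, in either direction, give \<open>\<one>\<close> and drop out.\<close>

definition basis :: "'a set" where
  "basis = {schreier C l | C l. C \<in> rcosets H \<and> l \<in> letters} - {\<one>}"

lemma schreier_basis: "C \<in> rcosets H \<Longrightarrow> l \<in> letters \<Longrightarrow> schreier C l \<in> insert \<one> basis"
  unfolding basis_def by blast

lemma basis_subset: "basis \<subseteq> H"
  unfolding basis_def using schreier_closed letters_closed by blast

lemma basis_carrier: "x \<in> basis \<Longrightarrow> x \<in> carrier G"
  using basis_subset subset by blast

lemma inv_basis: "x \<in> basis \<Longrightarrow> inv x \<in> basis"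
proof -
  assume x: "x \<in> basis"
  then obtain C l where "C \<in> rcosets H" "l \<in> letters" "x = schreier C l"
    unfolding basis_def by blast
  then have "inv x = schreier (C #> l) (inv l)" "C #> l \<in> rcosets H" "inv l \<in> letters"
    using schreier_inv letters_closed coset_closed inv_letters by auto
  moreover have "inv x \<noteq> \<one>" using x basis_carrier by (simp add: basis_def inv_eq_1_iff)
  ultimately show ?thesis unfolding basis_def by blast
qed

text \<open>As \<open>\<one>\<close> is excluded, the fixed points of this involution are exactly
  the elements of order two in \<open>basis\<close>.\<close>

lemma basis_involution: "involution_on basis (\<lambda>x. inv x)"
  unfolding involution_on_def using inv_basis basis_carrier by auto

lemma basis_surj:
  assumes "h \<in> H"
  shows "\<exists>y\<in>lists (basis \<times> UNIV). word_val G id y = h"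
proof -
  \<comment> \<open>Generalised from \<open>H\<close> to every start coset, since the coset moves as
    letters are read off.\<close>
  have "\<exists>y\<in>lists (basis \<times> UNIV). word_val G id y = schreier C g"
    if "g \<in> carrier G" "C \<in> rcosets H" for C g
    using that
  proof (induction arbitrary: C rule: letters_induct)
    case one
    then show ?case by (intro bexI[of _ "[]"]) (auto simp: schreier_one)
  next
    case (mult l g)
    then have l: "l \<in> carrier G" by (simp only: letters_closed)
    obtain y where y: "y \<in> lists (basis \<times> UNIV)" "word_val G id y = schreier (C #> l) g"
      using mult coset_closed l by blast
    have eq: "schreier C (l \<otimes> g) = schreier C l \<otimes> word_val G id y"
      using schreier_mult mult l y by simp
    have car: "word_val G id y \<in> carrier G"
      by (rule word_val_closed[OF _ y(1)]) (use basis_carrier in auto)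
    show ?case
    proof (cases "schreier C l = \<one>")
      case True
      then have "word_val G id y = schreier C (l \<otimes> g)" using eq car by simp
      then show ?thesis using y(1) by (rule bexI)
    next
      case False
      then have "schreier C l \<in> basis" using schreier_basis[OF mult.prems mult.hyps(1)] by simp
      then have "(schreier C l, True) # y \<in> lists (basis \<times> UNIV)" using y(1) by simp
      moreover have "word_val G id ((schreier C l, True) # y) = schreier C (l \<otimes> g)"
        using eq by (simp add: letter_val_def)
      ultimately show ?thesis by blast
    qed
  qed
  from this[of h H] have "\<exists>y\<in>lists (basis \<times> UNIV). word_val G id y = schreier H h"
    using assms subset subgroup_coset by blast
  \<comment> \<open>Both end cosets are \<open>H\<close>, whose representative is
    \<open>\<one>\<close>.\<close>
  moreover have "schreier H h = h"
    using assms subset rcos_const[OF is_group assms] by (simp add: schreier_def rep_subgroup)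
  ultimately show ?thesis by simp
qed

section \<open>The involution group on \<open>basis\<close> and the lift of ambient words into
  it\<close>

abbreviation "target \<equiv> involution_group basis (\<lambda>x. inv x)"
abbreviation "basis_words \<equiv> lists (basis \<times> (UNIV :: bool set))"
abbreviation "basis_rels \<equiv> inv_relators basis (\<lambda>x. inv x)"
abbreviation "basis_class \<equiv> pres_class basis basis_rels"

lemma target_group: "group target"
  unfolding involution_group_def by (rule group_presented_group)

interpretation target: group target
  by (rule target_group)

lemma basis_class_closed: "y \<in> basis_words \<Longrightarrow> basis_class y \<in> carrier target"
  unfolding involution_group_def carrier_presented_group by (rule imageI)

lemma basis_class_append:
  "u \<in> basis_words \<Longrightarrow> v \<in> basis_words \<Longrightarrow>
    basis_class (u @ v) = basis_class u \<otimes>\<^bsub>target\<^esub> basis_class v"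
  unfolding involution_group_def by (simp only: mult_presented_group)

lemma basis_class_Nil: "basis_class [] = \<one>\<^bsub>target\<^esub>"
  unfolding involution_group_def by (simp only: one_presented_group)

text \<open>The natural map from \<open>basis\<close> into \<open>target\<close>, with
  \<open>\<one>\<close> sent to the identity so that trivial Schreier generators need no separate
  case below.\<close>

definition embed :: "'a \<Rightarrow> 'a sword set" where
  "embed x = (if x = \<one> then \<one>\<^bsub>target\<^esub> else basis_class [(x, True)])"

lemma embed_closed: "x \<in> insert \<one> basis \<Longrightarrow> embed x \<in> carrier target"
  by (auto simp: embed_def intro!: basis_class_closed simp del: Image_singleton_iff)

lemma embed_basis: "x \<in> basis \<Longrightarrow> embed x = basis_class [(x, True)]"
  by (auto simp: embed_def basis_def)

lemma embed_inv:
  assumes "x \<in> insert \<one> basis"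
  shows "embed x \<otimes>\<^bsub>target\<^esub> embed (inv x) = \<one>\<^bsub>target\<^esub>"
proof (cases "x = \<one>")
  case True
  then show ?thesis by (simp add: embed_def)
next
  case False
  then have x: "x \<in> basis" "inv x \<in> basis" using assms inv_basis by auto
  then have w: "[(x, True)] \<in> basis_words" "[(inv x, True)] \<in> basis_words"
    "[(x, True), (inv x, True)] \<in> basis_words" by auto
  have "pres_eq basis basis_rels [(x, True), (inv x, True)] []"
    by (rule pres_eq.relator) (use x(1) w(3) in auto)
  then have "basis_class [(x, True), (inv x, True)] = basis_class []"
    using pres_class_eq_iff[OF w(3)] by blast
  then show ?thesis
    using basis_class_append[OF w(1,2)] by (simp only: embed_basis x basis_class_Nil append.simps)
qed

text \<open>Both sides are right inverses of \<open>embed x\<close>, one by formal cancellation and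
  the other by a relator.\<close>

lemma basis_class_inv_letter:
  assumes x: "x \<in> basis"
  shows "basis_class [(x, False)] = embed (inv x)"
proof -
  have w: "[(x, False)] \<in> basis_words" "[(x, True)] \<in> basis_words"
    "[(x, True), (x, False)] \<in> basis_words" using x by auto
  have "pres_eq basis basis_rels [(x, True), (x, False)] []"
    using pres_eq.cancel[OF x, of _ True] by simp
  then have "basis_class [(x, True), (x, False)] = basis_class []"
    using pres_class_eq_iff[OF w(3)] by blast
  then have "embed x \<otimes>\<^bsub>target\<^esub> basis_class [(x, False)] = \<one>\<^bsub>target\<^esub>"
    using basis_class_append[OF w(2,1)] by (simp only: embed_basis[OF x] basis_class_Nil append.simps)
  moreover have "embed x \<otimes>\<^bsub>target\<^esub> embed (inv x) = \<one>\<^bsub>target\<^esub>"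
    using x by (intro embed_inv) simp
  moreover have "embed x \<in> carrier target" "embed (inv x) \<in> carrier target"
    using x inv_basis by (auto intro: embed_closed)
  ultimately show ?thesis
    using target.Units_l_cancel[of "embed x" "basis_class [(x, False)]" "embed (inv x)"]
      basis_class_closed[OF w(1)] by (simp only: target.Units_eq simp_thms)
qed

text \<open>The lift of \<open>schreier C (val w)\<close> to \<open>target\<close>, letter by
  letter; the first argument is the coset reached so far. It is defined on words, and
  \<open>cocycle_pres_eq\<close> shows that it respects the ambient relations.\<close>

primrec cocycle :: "'a set \<Rightarrow> 'b sword \<Rightarrow> 'a sword set" where
  "cocycle C [] = \<one>\<^bsub>target\<^esub>"
| "cocycle C (b # w) =
    embed (schreier C (letter_val G f b)) \<otimes>\<^bsub>target\<^esub> cocycle (C #> letter_val G f b) w"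

lemma letter_embed_closed:
  "C \<in> rcosets H \<Longrightarrow> b \<in> A \<times> UNIV \<Longrightarrow> embed (schreier C (letter_val G f b)) \<in> carrier target"
  by (intro embed_closed schreier_basis imageI)

lemma letter_coset_closed:
  "C \<in> rcosets H \<Longrightarrow> b \<in> A \<times> UNIV \<Longrightarrow> C #> letter_val G f b \<in> rcosets H"
  by (intro coset_closed letter_val_closed[OF gen_closed])

lemma cocycle_closed:
  "w \<in> words \<Longrightarrow> C \<in> rcosets H \<Longrightarrow> cocycle C w \<in> carrier target"
  by (induction w arbitrary: C) (use letter_embed_closed letter_coset_closed in auto)

lemma cocycle_append:
  assumes "u \<in> words" "v \<in> words" "C \<in> rcosets H"
  shows "cocycle C (u @ v) = cocycle C u \<otimes>\<^bsub>target\<^esub> cocycle (C #> val u) v"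
  using assms(1,3)
proof (induction u arbitrary: C)
  case Nil
  then show ?case using cocycle_closed[OF assms(2)] coset_subset by simp
next
  case (Cons b u)
  then have b: "b \<in> A \<times> UNIV" and u: "u \<in> words" by auto
  let ?l = "letter_val G f b"
  have C': "C #> ?l \<in> rcosets H" using Cons b letter_coset_closed by blast
  have car: "?l \<in> carrier G" "val u \<in> carrier G"
    using b u letter_val_closed[OF gen_closed] word_val_closed[OF gen_closed] by auto
  have "embed (schreier C ?l) \<in> carrier target" "cocycle (C #> ?l) u \<in> carrier target"
    "cocycle ((C #> ?l) #> val u) v \<in> carrier target"
    using letter_embed_closed[OF Cons.prems b] cocycle_closed[OF u C']
      cocycle_closed[OF assms(2) coset_closed[OF C' car(2)]] .
  then show ?case
    using Cons.IH[OF C'] coset_assoc[OF Cons.prems car] by (simp add: target.m_assoc)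
qed

text \<open>An edge walked forth and back contributes some \<open>x\<close> and then
  \<open>inv x\<close>, which cancel by \<open>embed_inv\<close>. This serves both kinds of ambient
  relation: formal cancellation and the relators \<open>a\<close> followed by
  \<open>\<theta> a\<close>.\<close>

lemma cocycle_inverse_letters:
  assumes "b \<in> A \<times> UNIV" "c \<in> A \<times> UNIV" "C \<in> rcosets H"
    and inv: "letter_val G f c = inv letter_val G f b"
  shows "cocycle C [b, c] = \<one>\<^bsub>target\<^esub>"
proof -
  let ?l = "letter_val G f b"
  have l: "?l \<in> carrier G" using assms letter_val_closed[OF gen_closed] by auto
  have "embed (schreier C ?l) \<otimes>\<^bsub>target\<^esub> embed (inv schreier C ?l) = \<one>\<^bsub>target\<^esub>"
    using assms by (intro embed_inv schreier_basis imageI)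
  moreover have "embed (schreier (C #> ?l) (inv ?l)) \<in> carrier target"
    using letter_embed_closed[OF letter_coset_closed[OF assms(3,1)] assms(2)] inv by simp
  ultimately show ?thesis
    using assms(3) l inv by (simp add: schreier_inv)
qed

lemma cocycle_pres_eq:
  assumes "pres_eq A (inv_relators A \<theta>) u v" "C \<in> rcosets H"
  shows "cocycle C u = cocycle C v"
  using assms
proof (induction arbitrary: C rule: pres_eq.induct)
  case (append u v u' v')
  have uv: "u \<in> words" "v \<in> words" "u' \<in> words" "v' \<in> words"
    using pres_eq_in_lists[OF append(1)] pres_eq_in_lists[OF append(2)] by auto
  \<comment> \<open>Equal values ensure that the second factors are read from the same
    coset.\<close>
  have "val u = val v"
  proof (rule word_val_pres_eq[OF gen_closed _ append(1)])
    fix r assume "r \<in> inv_relators A \<theta>"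
    then obtain a where "a \<in> A" "r = [(a, True), (\<theta> a, True)]" by blast
    moreover from this have "f (\<theta> a) \<in> carrier G"
      using gen_closed involution_on_closed[OF involution] by auto
    ultimately show "val r = \<one>" using gen_inv by (simp add: letter_val_def)
  qed
  moreover have "C #> val u \<in> rcosets H"
    using append.prems uv word_val_closed[OF gen_closed] coset_closed by blast
  ultimately show ?case using append uv by (simp only: cocycle_append)
next
  case (cancel a s)
  then have "inv (inv f a) = f a" using gen_closed by (intro inv_inv) auto
  then have "cocycle C [(a, s), (a, \<not> s)] = \<one>\<^bsub>target\<^esub>"
    by (intro cocycle_inverse_letters) (use cancel in \<open>auto simp: letter_val_def\<close>)
  then show ?case by simp
next
  case (relator r)
  then obtain a where a: "a \<in> A" and r: "r = [(a, True), (\<theta> a, True)]" by blast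
  have "cocycle C r = \<one>\<^bsub>target\<^esub>"
    unfolding r
    by (rule cocycle_inverse_letters)
      (use a relator involution_on_closed[OF involution] inv_gen in \<open>auto simp: letter_val_def\<close>)
  then show ?case by simp
qed auto

text \<open>Along a branch of the Schreier tree all Schreier generators are trivial.\<close>

lemma cocycle_rep:
  assumes "C \<in> rcosets H"
  shows "\<exists>u\<in>words. \<exists>v\<in>words. val u = rep C \<and> cocycle H u = \<one>\<^bsub>target\<^esub> \<and>
    val v = inv rep C \<and> cocycle C v = \<one>\<^bsub>target\<^esub>"
  using assms
proof (induction "depth C" arbitrary: C rule: less_induct)
  case less
  show ?case
  proof (cases "C = H")
    case True
    then show ?thesis by (intro bexI[of _ "[]"]) (auto simp: rep_subgroup)
  next
    case False
    then obtain D l where D: "D \<in> rcosets H" "l \<in> letters" "depth D < depth C" "D #> l = C"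
      and repC: "rep C = rep D \<otimes> l"
      using rep_parent[OF less.prems] by blast
    then obtain u v where uv: "u \<in> words" "v \<in> words" "val u = rep D" "val v = inv rep D"
      "cocycle H u = \<one>\<^bsub>target\<^esub>" "cocycle D v = \<one>\<^bsub>target\<^esub>"
      using less.hyps by blast
    obtain b where b: "b \<in> A \<times> UNIV" "letter_val G f b = l" using D(2) by blast
    obtain c where c: "c \<in> A \<times> UNIV" "letter_val G f c = inv l"
      using inv_letters[OF D(2)] by (metis imageE)
    have car: "l \<in> carrier G" "rep D \<in> carrier G" "rep C \<in> carrier G"
      using D letters_closed rep_closed less.prems by auto
    \<comment> \<open>The edge from \<open>D\<close> to \<open>C\<close> belongs to the tree, so
      neither of its directions contributes.\<close>
    have one: "schreier D l = \<one>" using car D(4) repC by (simp add: schreier_def)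
    then have one': "schreier C (inv l) = \<one>"
      using schreier_inv[OF D(1) car(1)] D(4) by simp
    have CD: "C #> inv l = D" using coset_cancel[OF D(1) car(1)] D(4) by simp
    \<comment> \<open>The way out to \<open>C\<close> grows at its end, the way back at its
      front.\<close>
    have w: "u @ [b] \<in> words" "[b] \<in> words" "c # v \<in> words" using b c uv by auto
    have "val (u @ [b]) = rep C"
      using word_val_append[OF gen_closed uv(1) w(2)] b uv car repC by simp
    moreover have "cocycle H (u @ [b]) = \<one>\<^bsub>target\<^esub>"
      using cocycle_append[OF uv(1) w(2) subgroup_coset] uv b one coset_rep[OF D(1)]
      by (simp add: embed_def)
    moreover have "val (c # v) = inv rep C"
      using c uv car repC by (simp add: inv_mult_group)
    moreover have "cocycle C (c # v) = \<one>\<^bsub>target\<^esub>"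
      using c uv one' CD by (simp add: embed_def)
    ultimately show ?thesis using w by blast
  qed
qed

text \<open>Walk along the tree to \<open>C\<close>, cross the edge \<open>l\<close>, and return to
  \<open>H\<close> along the tree from \<open>C #> l\<close>: only the middle edge
  contributes.\<close>

lemma cocycle_basis:
  assumes "x \<in> basis"
  shows "\<exists>w\<in>words. val w = x \<and> cocycle H w = embed x"
proof -
  obtain C l where C: "C \<in> rcosets H" "l \<in> letters" "x = schreier C l"
    using assms unfolding basis_def by blast
  have car: "l \<in> carrier G" "rep C \<in> carrier G" "rep (C #> l) \<in> carrier G"
    and D: "C #> l \<in> rcosets H"
    using C letters_closed rep_closed coset_closed by auto
  obtain b where b: "b \<in> A \<times> UNIV" "letter_val G f b = l" using C(2) by blast
  obtain u where u: "u \<in> words" "val u = rep C" "cocycle H u = \<one>\<^bsub>target\<^esub>"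
    using cocycle_rep[OF C(1)] by blast
  obtain v where v: "v \<in> words" "val v = inv rep (C #> l)" "cocycle (C #> l) v = \<one>\<^bsub>target\<^esub>"
    using cocycle_rep[OF D] by blast
  have bv: "b # v \<in> words" and ubv: "u @ b # v \<in> words" using b u v by auto
  have "val (u @ b # v) = x"
    using word_val_append[OF gen_closed u(1) bv] b u v car C(3) by (simp add: schreier_def m_assoc)
  moreover have "embed x \<in> carrier target" using assms by (simp add: embed_closed)
  then have "cocycle H (u @ b # v) = embed x"
    using cocycle_append[OF u(1) bv subgroup_coset] b u v coset_rep[OF C(1)] C(3) by simp
  ultimately show ?thesis using ubv by blast
qed

text \<open>Elements of \<open>basis\<close> lie in \<open>H\<close>, so the walk lifting one letter
  closes up at \<open>H\<close> and the next starts there again; hence the cocycles of concatenated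
  walks multiply.\<close>

lemma cocycle_basis_word:
  assumes "y \<in> basis_words"
  shows "\<exists>w\<in>words. val w = word_val G id y \<and> cocycle H w = basis_class y"
  using assms
proof (induction y)
  case Nil
  then show ?case by (intro bexI[of _ "[]"]) (simp_all only: word_val_Nil cocycle.simps basis_class_Nil lists.Nil)
next
  case (Cons b y)
  obtain x s where b: "b = (x, s)" by (cases b)
  then have x: "x \<in> basis" and y: "y \<in> basis_words" and b': "[b] \<in> basis_words"
    using Cons by auto
  \<comment> \<open>A formal inverse letter is lifted as the positive letter of the inverse element,
    which has the same class.\<close>
  define z where "z = (if s then x else inv x)"
  have z: "z \<in> basis" using x inv_basis by (simp add: z_def)
  have emb: "basis_class [b] = embed z"
    using x by (cases s) (simp_all only: b z_def embed_basis basis_class_inv_letter if_True if_False)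
  obtain v where v: "v \<in> words" "val v = z" "cocycle H v = embed z"
    using cocycle_basis[OF z] by blast
  obtain w where w: "w \<in> words" "val w = word_val G id y" "cocycle H w = basis_class y"
    using Cons y by blast
  have "H #> z = H" using z basis_subset rcos_const[OF is_group] by auto
  then have "cocycle H (v @ w) = basis_class [b] \<otimes>\<^bsub>target\<^esub> basis_class y"
    using cocycle_append[OF v(1) w(1) subgroup_coset] by (simp only: v w emb)
  also have "\<dots> = basis_class (b # y)" using basis_class_append[OF b' y] by simp
  finally have "cocycle H (v @ w) = basis_class (b # y)" .
  moreover have "val (v @ w) = word_val G id (b # y)"
    using word_val_append[OF gen_closed v(1) w(1)] v w b by (simp add: letter_val_def z_def)
  moreover have "v @ w \<in> words" using v w by simp
  ultimately show ?case by blast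
qed

text \<open>Lift \<open>y\<close> to an ambient word of value \<open>\<one>\<close>. The ambient
  relations reduce it to \<open>[]\<close>, and the invariance of the cocycle carries this reduction
  back to \<open>y\<close>.\<close>

lemma basis_faithful:
  assumes y: "y \<in> basis_words" "word_val G id y = \<one>"
  shows "pres_eq basis basis_rels y []"
proof -
  obtain w where w: "w \<in> words" "val w = \<one>" "cocycle H w = basis_class y"
    using cocycle_basis_word[OF y(1)] y(2) by auto
  have "cocycle H w = cocycle H []"
    using gen_faithful[OF w(1,2)] subgroup_coset by (rule cocycle_pres_eq)
  then have "basis_class y = basis_class []" by (simp only: w(3) cocycle.simps basis_class_Nil)
  then show ?thesis using pres_class_eq_iff[OF y(1)] by blast
qed

theorem subgroup_iso: "G\<lparr>carrier := H\<rparr> \<cong> target"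
proof -
  interpret K: group "G\<lparr>carrier := H\<rparr>" by (rule subgroup_is_group[OF is_group])
  have inv_eq: "inv\<^bsub>G\<lparr>carrier := H\<rparr>\<^esub> x = inv x" if "x \<in> H" for x
    using m_inv_consistent[OF subgroup_axioms that] by simp
  \<comment> \<open>The isomorphism criterion evaluates inside the subgroup, whereas
    \<open>basis_surj\<close> and \<open>basis_faithful\<close> evaluate in
    \<open>G\<close>.\<close>
  have val: "word_val (G\<lparr>carrier := H\<rparr>) id y = word_val G id y" if "y \<in> basis_words" for y
    using that
  proof (induction y)
    case (Cons b y)
    then have "fst b \<in> H" using basis_subset by auto
    then have "letter_val (G\<lparr>carrier := H\<rparr>) id b = letter_val G id b"
      by (simp add: letter_val_def inv_eq)
    then show ?case by (simp add: Cons.IH del: id_apply)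
  qed simp
  have "target \<cong> G\<lparr>carrier := H\<rparr>"
    unfolding involution_group_def
  proof (rule K.presented_group_iso)
    show "id \<in> basis \<rightarrow> carrier (G\<lparr>carrier := H\<rparr>)" using basis_subset by auto
    show "word_val (G\<lparr>carrier := H\<rparr>) id r = \<one>\<^bsub>G\<lparr>carrier := H\<rparr>\<^esub>"
      if r: "r \<in> basis_rels" "r \<in> basis_words" for r
    proof -
      obtain x where "x \<in> basis" "r = [(x, True), (inv x, True)]" using r(1) by blast
      then show ?thesis using val[OF r(2)] basis_carrier by (simp add: letter_val_def)
    qed
    show "\<exists>y\<in>basis_words. word_val (G\<lparr>carrier := H\<rparr>) id y = h"
      if "h \<in> carrier (G\<lparr>carrier := H\<rparr>)" for h
      using basis_surj[of h] that val by auto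
    show "pres_eq basis basis_rels y []"
      if "y \<in> basis_words" "word_val (G\<lparr>carrier := H\<rparr>) id y = \<one>\<^bsub>G\<lparr>carrier := H\<rparr>\<^esub>" for y
      using that val by (intro basis_faithful) auto
  qed
  then show ?thesis by (rule group.iso_sym[OF target_group])
qed

end

section \<open>Specular groups and finite generation\<close>

text \<open>Cancellation removes two copies of one letter, and a relator has both letters in one
  orbit of \<open>\<theta>\<close>; so the count for the orbit of \<open>a\<close> changes by zero
  or two. Letters and their formal inverses are counted alike.\<close>

lemma even_letter_count_pres_eq:
  assumes inv: "involution_on A \<theta>" and a: "a \<in> A"
    and "pres_eq A (inv_relators A \<theta>) u v"
  shows "even (length (filter (\<lambda>l. fst l \<in> {a, \<theta> a}) u)) \<longleftrightarrow>
    even (length (filter (\<lambda>l. fst l \<in> {a, \<theta> a}) v))"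
  using assms(3)
proof (induction rule: pres_eq.induct)
  case (relator r)
  then obtain b where b: "b \<in> A" "r = [(b, True), (\<theta> b, True)]" by blast
  have "\<theta> b \<in> {a, \<theta> a} \<longleftrightarrow> b \<in> {a, \<theta> a}"
    using involution_on_involutive[OF inv] a b(1) by (metis insert_iff singletonD)
  then show ?case using b(2) by simp
qed auto

text \<open>Finitely many words use finitely many letters. An infinite \<open>A\<close> would
  contain an orbit avoided by all of them, and the generators would lie in the kernel of its parity
  map, a proper subgroup.\<close>

lemma finitely_generated_involution_group:
  assumes inv: "involution_on A \<theta>" and fg: "finitely_generated (involution_group A \<theta>)"
  shows "finite A"
proof (rule ccontr)
  assume "infinite A"
  let ?R = "inv_relators A \<theta>"
  let ?P = "presented_group A ?R"
  let ?W = "lists (A \<times> (UNIV :: bool set))"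
  interpret P: group ?P by (rule group_presented_group)
  obtain S where S: "finite S" "S \<subseteq> carrier ?P" "generate ?P S = carrier ?P"
    using fg unfolding finitely_generated_def involution_group_def by blast
  from S(2) have "\<forall>X\<in>S. \<exists>w. w \<in> ?W \<and> X = pres_class A ?R w"
    unfolding carrier_presented_group by blast
  from bchoice[OF this] obtain w
    where w: "\<And>X. X \<in> S \<Longrightarrow> w X \<in> ?W" "\<And>X. X \<in> S \<Longrightarrow> X = pres_class A ?R (w X)"
    by blast
  define B where "B = (\<Union>X\<in>S. fst ` set (w X))"
  \<comment> \<open>The image of \<open>B\<close> under \<open>\<theta>\<close> is avoided as well,
    to keep \<open>\<theta> a\<close> out of \<open>B\<close>.\<close>
  have "finite (B \<union> \<theta> ` B)" using S(1) by (simp add: B_def)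
  then obtain a where a: "a \<in> A" "a \<notin> B" "a \<notin> \<theta> ` B"
    using \<open>infinite A\<close> by (metis UnCI finite_subset subsetI)
  have "\<theta> a \<notin> B"
  proof
    assume "\<theta> a \<in> B"
    then have "\<theta> (\<theta> a) \<in> \<theta> ` B" by (rule imageI)
    then show False using involution_on_involutive[OF inv a(1)] a(3) by simp
  qed
  define n where "n u = length (filter (\<lambda>l. fst l \<in> {a, \<theta> a}) u)" for u :: "'a sword"
  have n_append: "n (u @ v) = n u + n v" for u v by (simp add: n_def)
  have n_pres_eq: "even (n u) \<longleftrightarrow> even (n v)" if "pres_eq A ?R u v" for u v
    unfolding n_def by (rule even_letter_count_pres_eq[OF inv a(1) that])
  \<comment> \<open>The kernel of the parity map onto the group of order two.\<close>
  define Q where "Q = pres_class A ?R ` {u \<in> ?W. even (n u)}"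
  have "subgroup Q ?P"
  proof (rule P.subgroupI)
    show "Q \<subseteq> carrier ?P" unfolding Q_def carrier_presented_group by (rule image_mono) blast
    have "[] \<in> {u \<in> ?W. even (n u)}" by (simp add: n_def)
    then show "Q \<noteq> {}" unfolding Q_def by blast
  next
    fix X assume "X \<in> Q"
    then obtain u where u: "u \<in> ?W" "even (n u)" "X = pres_class A ?R u" unfolding Q_def by blast
    let ?v = "sword_inv u"
    have v: "?v \<in> ?W" "?v @ u \<in> ?W" using u(1) sword_inv_in_lists[OF u(1)] by auto
    have vu: "pres_eq A ?R (?v @ u) []" by (rule pres_eq_sword_inv[OF u(1)])
    then have "pres_class A ?R (?v @ u) = pres_class A ?R []"
      using pres_class_eq_iff[OF v(2)] by blast
    then have "pres_class A ?R ?v \<otimes>\<^bsub>?P\<^esub> X = \<one>\<^bsub>?P\<^esub>"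
      by (simp only: u(3) mult_presented_group[OF v(1) u(1)] one_presented_group)
    moreover have "X \<in> carrier ?P" "pres_class A ?R ?v \<in> carrier ?P"
      unfolding carrier_presented_group u(3) using u(1) v(1) by (blast intro: imageI)+
    ultimately have "inv\<^bsub>?P\<^esub> X = pres_class A ?R ?v" by (rule P.inv_equality)
    \<comment> \<open>\<open>?v @ u\<close> is equivalent to the empty word, so its two parts have
      the same parity.\<close>
    moreover have "even (n ?v)" using n_pres_eq[OF vu] u(2) n_append by (simp add: n_def)
    ultimately show "inv\<^bsub>?P\<^esub> X \<in> Q" unfolding Q_def using v(1) by blast
  next
    fix X Y assume "X \<in> Q" "Y \<in> Q"
    then obtain u v where uv: "u \<in> ?W" "even (n u)" "v \<in> ?W" "even (n v)"
      and XY: "X = pres_class A ?R u" "Y = pres_class A ?R v" unfolding Q_def by blast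
    have "u @ v \<in> {u \<in> ?W. even (n u)}" using uv n_append by simp
    then show "X \<otimes>\<^bsub>?P\<^esub> Y \<in> Q"
      unfolding XY mult_presented_group[OF uv(1,3)] Q_def by (rule imageI)
  qed
  moreover have "S \<subseteq> Q"
  proof
    fix X assume X: "X \<in> S"
    have "fst l \<notin> {a, \<theta> a}" if "l \<in> set (w X)" for l
    proof -
      have "fst l \<in> B" unfolding B_def using X that by blast
      then show ?thesis using a(2) \<open>\<theta> a \<notin> B\<close> by auto
    qed
    then have "filter (\<lambda>l. fst l \<in> {a, \<theta> a}) (w X) = []" by (simp only: filter_empty_conv) blast
    then have "n (w X) = 0" by (simp only: n_def list.size)
    then have "w X \<in> {u \<in> ?W. even (n u)}" using w(1)[OF X] by simp
    then show "X \<in> Q" unfolding Q_def by (subst w(2)[OF X]) (rule imageI)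
  qed
  ultimately have incl: "carrier ?P \<subseteq> Q" unfolding S(3)[symmetric]
    by (intro P.generate_subgroup_incl)
  have aW: "[(a, True)] \<in> ?W" using a(1) by simp
  then have "pres_class A ?R [(a, True)] \<in> carrier ?P"
    unfolding carrier_presented_group by (rule imageI)
  then have "pres_class A ?R [(a, True)] \<in> Q" by (rule subsetD[OF incl])
  then obtain u where u: "u \<in> ?W" "even (n u)" "pres_class A ?R [(a, True)] = pres_class A ?R u"
    unfolding Q_def by blast
  then have "pres_eq A ?R [(a, True)] u" using pres_class_eq_iff[OF aW u(1)] by blast
  then have "even (n [(a, True)])" using n_pres_eq u(2) by blast
  then show False by (simp add: n_def)
qed

section \<open>Transport along isomorphisms and relabellings, and the conclusion\<close>

lemma finitely_generated_iso:
  assumes "group G" "group K" "G \<cong> K" "finitely_generated G"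
  shows "finitely_generated K"
proof -
  obtain h where h: "h \<in> iso G K" using assms(3) unfolding is_iso_def by blast
  then have hom: "h \<in> hom G K" and img: "h ` carrier G = carrier K"
    unfolding iso_def bij_betw_def by blast+
  interpret group_hom G K h
    using assms(1,2) hom by (simp add: group_hom_def group_hom_axioms_def)
  obtain S where S: "finite S" "S \<subseteq> carrier G" "generate G S = carrier G"
    using assms(4) unfolding finitely_generated_def by blast
  have "generate K (h ` S) = carrier K" using generate_img[OF S(2)] S(3) img by simp
  moreover have "h ` S \<subseteq> carrier K" using S(2) img by blast
  ultimately show ?thesis unfolding finitely_generated_def using S(1) by blast
qed

text \<open>Conjugating \<open>\<theta>\<close> by \<open>f\<close> carries relators to relators.
  The alphabet may be infinite here, so a countable one can be moved into the naturals.\<close>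

lemma involution_group_relabel:
  assumes f: "inj_on f A" and inv: "involution_on A \<theta>"
  shows "\<exists>\<tau>. involution_on (f ` A) \<tau> \<and> involution_group A \<theta> \<cong> involution_group (f ` A) \<tau>"
proof -
  define \<tau> where "\<tau> = f \<circ> \<theta> \<circ> inv_into A f"
  have tau: "\<tau> (f a) = f (\<theta> a)" if "a \<in> A" for a
    using that f by (simp add: \<tau>_def)
  have inv': "involution_on (f ` A) \<tau>"
    using inv tau by (auto simp: involution_on_def Pi_iff)
  have "map (map_prod f id) ` inv_relators A \<theta> = inv_relators (f ` A) \<tau>"
    using tau by (auto simp: image_iff) force+
  moreover have "inv_relators A \<theta> \<subseteq> lists (A \<times> UNIV)"
    using involution_on_closed[OF inv] by auto
  ultimately have "involution_group A \<theta> \<cong> involution_group (f ` A) \<tau>"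
    using presented_group_relabel[OF f, of "inv_relators A \<theta>"]
    by (simp only: involution_group_def)
  then show ?thesis using inv' by blast
qed

theorem theorem3p3:
  fixes G :: "('g, 'm) monoid_scheme" and H :: "'g set"
  assumes "specular_group G" and "subgroup H G"
  shows "countable_specular_group (G\<lparr>carrier := H\<rparr>) \<and>
    (finitely_generated (G\<lparr>carrier := H\<rparr>) \<longrightarrow> specular_group (G\<lparr>carrier := H\<rparr>))"
proof -
  let ?K = "G\<lparr>carrier := H\<rparr>"
  obtain A :: "nat set" and \<theta> where G: "group G" and inv: "involution_on A \<theta>"
    and iso: "G \<cong> involution_group A \<theta>"
    using assms(1) unfolding specular_group_def by blast
  obtain f where f: "f \<in> A \<rightarrow> carrier G"
    "\<And>a. a \<in> A \<Longrightarrow> f a \<otimes>\<^bsub>G\<^esub> f (\<theta> a) = \<one>\<^bsub>G\<^esub>"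
    "\<And>g. g \<in> carrier G \<Longrightarrow> \<exists>w\<in>lists (A \<times> UNIV). word_val G f w = g"
    "\<And>w. w \<in> lists (A \<times> UNIV) \<Longrightarrow> word_val G f w = \<one>\<^bsub>G\<^esub> \<Longrightarrow>
      pres_eq A (inv_relators A \<theta>) w []"
    using involution_group_isoE[OF G inv iso] by blast
  interpret specular_subgroup G H A \<theta> f
    unfolding specular_subgroup_def specular_subgroup_axioms_def
    using G assms(2) inv f by blast
  let ?X = basis
  let ?F = "involution_group ?X (\<lambda>x. inv\<^bsub>G\<^esub> x)"
  have K: "group ?K" by (rule subgroup_is_group[OF G])
  have KF: "?K \<cong> ?F" by (rule subgroup_iso)
  \<comment> \<open>There are only countably many words over the naturals, and their values exhaust
    \<open>G\<close>. Thus \<open>basis\<close> is countable and can be coded by natural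
    numbers.\<close>
  have "carrier G \<subseteq> range (word_val G f)" using f(3) by blast
  then have "countable (carrier G)" by (rule countable_subset) simp
  then have "countable ?X" using basis_carrier by (meson countable_subset subsetI)
  then obtain c :: "'g \<Rightarrow> nat" where "inj_on c ?X" by (auto simp: countable_def)
  from involution_group_relabel[OF this basis_involution] obtain \<tau>
    where "involution_on (c ` ?X) \<tau>" "?F \<cong> involution_group (c ` ?X) \<tau>" by blast
  then have "countable_specular_group ?K"
    unfolding countable_specular_group_def using K iso_trans[OF KF] by blast
  moreover have "specular_group ?K" if "finitely_generated ?K"
  proof -
    \<comment> \<open>Finite generation is moved to the presented group, where it forces the
      alphabet \<open>basis\<close> itself to be finite.\<close>
    have "finitely_generated ?F"
      by (rule finitely_generated_iso[OF K target_group KF that])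
    then have "finite ?X" by (rule finitely_generated_involution_group[OF basis_involution])
    then have "specular_group ?F" using basis_involution by (rule specular_group_involution_group)
    then obtain B :: "nat set" and \<sigma> where "finite B" "involution_on B \<sigma>"
      "?F \<cong> involution_group B \<sigma>"
      unfolding specular_group_def by blast
    then show ?thesis unfolding specular_group_def using K iso_trans[OF KF] by blast
  qed
  ultimately show ?thesis by blast
qed

end
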